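(* Let $m\geq 4$ be an integer and let $G$ be an $m$-free digraph. Then $\beta(G)\leq \frac{1}{m-2}\,\gamma(G)$.
   Context: All digraphs are finite, without loops and without parallel edges. A digraph $G$ is $m$-free if it has no directed cycle of length at most $m$. A digraph is acyclic if it has no directed cycle. $\beta(G)$ denotes the minimum size of a set $X\subseteq E(G)$ of edges such that $G-X$ is acyclic. $\gamma(G)$ denotes the number of unordered pairs $\{a,b\}$ of distinct vertices of $G$ such that neither $(a,b)$ nor $(b,a)$ is an edge of $G$. *)

theory Defs
  imports Complex_Main
begin

definition digraph :: "'a set \<Rightarrow> ('a \<times> 'a) set \<Rightarrow> bool" where
  "digraph V E \<longleftrightarrow> finite V \<and> E \<subseteq> V \<times> V \<and> (\<forall>v. (v, v) \<notin> E)"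

definition is_dcycle :: "('a \<times> 'a) set \<Rightarrow> 'a list \<Rightarrow> bool" where
  "is_dcycle E vs \<longleftrightarrow> vs \<noteq> [] \<and> distinct vs \<and>
     (\<forall>i < length vs - 1. (vs ! i, vs ! (i + 1)) \<in> E) \<and>
     (last vs, hd vs) \<in> E"

definition m_free :: "nat \<Rightarrow> ('a \<times> 'a) set \<Rightarrow> bool" where
  "m_free m E \<longleftrightarrow> \<not> (\<exists>vs. is_dcycle E vs \<and> length vs \<le> m)"

definition dacyclic :: "('a \<times> 'a) set \<Rightarrow> bool" where
  "dacyclic E \<longleftrightarrow> \<not> (\<exists>vs. is_dcycle E vs)"

definition beta :: "('a \<times> 'a) set \<Rightarrow> nat" where
  "beta E = Min {card X | X. X \<subseteq> E \<and> dacyclic (E - X)}"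

definition gamma :: "'a set \<Rightarrow> ('a \<times> 'a) set \<Rightarrow> nat" where
  "gamma V E = card {{a, b} | a b. a \<in> V \<and> b \<in> V \<and> a \<noteq> b \<and>
                                    (a, b) \<notin> E \<and> (b, a) \<notin> E}"

end

theory Submission
  imports Defs
begin

text \<open>
  By induction on the number of vertices it suffices to find a nontrivial cut \<open>(S, V - S)\<close> for which
  \<open>m - 2\<close> times the number of edges from \<open>S\<close> to \<open>V - S\<close> is at most the number of nonadjacent pairs
  across it. Call \<open>(u, w, z)\<close> a geodesic triple of type \<open>(j, k)\<close> if \<open>d(u, w) = j\<close>, \<open>d(w, z) = k\<close> and
  \<open>d(u, z) = j + k\<close>. Among all types \<open>(i, 1)\<close> and \<open>(1, i)\<close> with \<open>1 \<le> i \<le> m - 2\<close> choose the rarest;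
  reversing all edges, we may assume that it is \<open>(i, 1)\<close>. Average the cuts
  \<open>S w = {z. 1 \<le> d(w, z) \<le> i}\<close> over all vertices \<open>w\<close>. An edge \<open>(x, y)\<close> leaving \<open>S w\<close> makes \<open>(w, x, y)\<close>
  a geodesic triple of type \<open>(i, 1)\<close>. Conversely, since there are no short cycles, each geodesic
  triple \<open>(u, w, z)\<close> of one of the \<open>m - 2\<close> types \<open>(1, 1), \<dots>, (m - 1 - i, 1)\<close> and
  \<open>(1, 2), \<dots>, (1, i)\<close> yields a nonadjacent pair \<open>z \<in> S w\<close>, \<open>u \<notin> S w\<close>.
\<close>

text \<open>A relation in place of a distance function, so that unreachable pairs need no value;
  \<open>at_dist E 0\<close> is the identity.\<close>

definition at_dist :: "('a \<times> 'a) set \<Rightarrow> nat \<Rightarrow> ('a \<times> 'a) set" where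
  "at_dist E k = {(x, y). (x, y) \<in> E ^^ k \<and> (\<forall>j<k. (x, y) \<notin> E ^^ j)}"

definition geodesic_triples :: "('a \<times> 'a) set \<Rightarrow> nat \<Rightarrow> nat \<Rightarrow> ('a \<times> 'a \<times> 'a) set" where
  "geodesic_triples E j k =
     {(u, w, z). (u, w) \<in> at_dist E j \<and> (w, z) \<in> at_dist E k \<and> (u, z) \<in> at_dist E (j + k)}"

definition cut_edges :: "('a \<times> 'a) set \<Rightarrow> 'a set \<Rightarrow> ('a \<times> 'a) set" where
  "cut_edges E S = {(x, y). (x, y) \<in> E \<and> x \<in> S \<and> y \<notin> S}"

text \<open>Listing the end in \<open>S\<close> first makes each unordered pair across the cut occur
  exactly once.\<close>

definition cut_nonedges :: "'a set \<Rightarrow> ('a \<times> 'a) set \<Rightarrow> 'a set \<Rightarrow> ('a \<times> 'a) set" where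
  "cut_nonedges V E S = {(x, y). x \<in> S \<and> y \<in> V - S \<and> (x, y) \<notin> E \<and> (y, x) \<notin> E}"

section \<open>Directed cycles and closed walks\<close>

lemma is_dcycle_trancl:
  assumes "is_dcycle E vs"
  shows "(hd vs, hd vs) \<in> E\<^sup>+"
proof -
  have ne: "vs \<noteq> []" and step: "\<And>i. i < length vs - 1 \<Longrightarrow> (vs ! i, vs ! (i + 1)) \<in> E"
    and closing: "(last vs, hd vs) \<in> E"
    using assms by (auto simp: is_dcycle_def)
  have "(vs ! 0, vs ! i) \<in> E\<^sup>*" if "i < length vs" for i
    using that
  proof (induction i)
    case (Suc i)
    then show ?case using step[of i] by (auto intro: rtrancl_into_rtrancl)
  qed simp
  then have "(hd vs, last vs) \<in> E\<^sup>*"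
    using ne by (simp add: hd_conv_nth last_conv_nth)
  then show ?thesis using closing by (rule rtrancl_into_trancl1)
qed

text \<open>Feedback arc sets are built with the library notion \<open>acyclic\<close>; this makes
  them candidates in the minimum \<open>beta\<close>.\<close>

lemma acyclic_imp_dacyclic: "acyclic E \<Longrightarrow> dacyclic E"
  by (auto simp: dacyclic_def acyclic_def dest: is_dcycle_trancl)

text \<open>A shortest closed walk of positive length is a cycle, since a repeated vertex would
  split off a shorter closed walk.\<close>

lemma m_free_no_closed_walk:
  assumes free: "m_free m E" and n: "1 \<le> n" "n \<le> m"
  shows "(x, x) \<notin> E ^^ n"
proof
  assume closed: "(x, x) \<in> E ^^ n"
  \<comment> \<open>The start vertex is quantified inside \<open>?P\<close>, so minimality also
    covers closed subwalks based at other vertices.\<close>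
  let ?P = "\<lambda>n. 1 \<le> n \<and> (\<exists>x. (x, x) \<in> E ^^ n)"
  define l where "l = (LEAST n. ?P n)"
  have "?P n" using n closed by blast
  then have "?P l" and "l \<le> n"
    unfolding l_def by (rule LeastI, rule Least_le)
  then obtain y where l1: "1 \<le> l" and y: "(y, y) \<in> E ^^ l" by blast
  have minimal: "l \<le> k" if "?P k" for k
    unfolding l_def using that by (rule Least_le)
  obtain f where f: "f 0 = y" "f l = y" "\<And>i. i < l \<Longrightarrow> (f i, f (Suc i)) \<in> E"
    using y unfolding relpow_fun_conv by blast
  have sub: "(f a, f b) \<in> E ^^ (b - a)" if "a \<le> b" "b \<le> l" for a b
    unfolding relpow_fun_conv
    using that f(3) by (intro exI[of _ "\<lambda>i. f (a + i)"]) auto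
  have ne: "f a \<noteq> f b" if "a < b" "b < l" for a b
  proof
    assume "f a = f b"
    then have "?P (b - a)" using sub[of a b] that by auto
    then show False using minimal[of "b - a"] that by simp
  qed
  have "inj_on f {0..<l}"
    by (rule linorder_inj_onI') (use ne in auto)
  then have "is_dcycle E (map f [0..<l])"
    unfolding is_dcycle_def using l1 f
    by (auto simp: distinct_map last_map hd_map) (metis Suc_pred lessI less_eq_Suc_le One_nat_def)
  then show False
    using free \<open>l \<le> n\<close> n by (auto simp: m_free_def)
qed

section \<open>Distances\<close>

lemma at_dist_unique:
  "(x, y) \<in> at_dist E j \<Longrightarrow> (x, y) \<in> at_dist E k \<Longrightarrow> j = k"
  unfolding at_dist_def by (cases j k rule: linorder_cases) auto

lemma relpow_imp_at_dist:
  assumes "(x, y) \<in> E ^^ n"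
  obtains k where "k \<le> n" "(x, y) \<in> at_dist E k"
proof
  let ?k = "LEAST k. (x, y) \<in> E ^^ k"
  show "?k \<le> n" using assms by (rule Least_le)
  show "(x, y) \<in> at_dist E ?k"
    using LeastI[of "\<lambda>k. (x, y) \<in> E ^^ k", OF assms] not_less_Least[of _ "\<lambda>k. (x, y) \<in> E ^^ k"]
    by (auto simp: at_dist_def)
qed

lemma at_dist_relpow: "(x, y) \<in> at_dist E k \<Longrightarrow> (x, y) \<in> E ^^ k"
  by (simp add: at_dist_def)

text \<open>The bound \<open>1 \<le> k\<close> excludes \<open>E ^^ 0\<close>, the identity on the
  whole type.\<close>

lemma relpow_subset_carrier:
  assumes "E \<subseteq> V \<times> V" "1 \<le> k"
  shows "E ^^ k \<subseteq> V \<times> V"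
proof -
  have "E ^^ Suc n \<subseteq> V \<times> V" for n
    by (induction n) (use assms in auto)
  then show ?thesis using assms(2) by (cases k) auto
qed

lemma at_dist_carrier:
  assumes "digraph V E" "1 \<le> k" "(x, y) \<in> at_dist E k"
  shows "x \<in> V" "y \<in> V"
  using relpow_subset_carrier[of E V k] assms by (auto simp: digraph_def at_dist_def)

lemma edge_at_dist_1:
  assumes "digraph V E" "(x, y) \<in> E"
  shows "(x, y) \<in> at_dist E 1"
  using assms by (auto simp: digraph_def at_dist_def)

text \<open>An edge from \<open>x\<close> to \<open>y\<close> would shorten the distance; an edge
  back would close a walk of length \<open>k + 1 \<le> m\<close>.\<close>

lemma at_dist_nonadjacent:
  assumes free: "m_free m E" and k: "2 \<le> k" "k \<le> m - 1" and xy: "(x, y) \<in> at_dist E k"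
  shows "(x, y) \<notin> E" "(y, x) \<notin> E"
proof -
  have "\<forall>j<k. (x, y) \<notin> E ^^ j" using xy by (simp add: at_dist_def)
  then have "(x, y) \<notin> E ^^ 1" using k by (metis Suc_1 Suc_le_lessD One_nat_def)
  then show "(x, y) \<notin> E" by simp
  show "(y, x) \<notin> E"
  proof
    assume "(y, x) \<in> E"
    with xy have "(x, x) \<in> E ^^ Suc k" by (auto simp: at_dist_def)
    then show False using m_free_no_closed_walk[OF free, of "Suc k" x] k by force
  qed
qed

section \<open>Reversal of all edges\<close>

lemma relpow_converse: "((E :: ('a \<times> 'a) set)\<inverse>) ^^ n = (E ^^ n)\<inverse>"
proof (induction n)
  case (Suc n)
  have "(E\<inverse>) ^^ Suc n = (E O E ^^ n)\<inverse>" by (simp add: Suc converse_relcomp)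
  then show ?case by (simp add: relpow_commute)
qed simp

lemma at_dist_converse: "at_dist (E\<inverse>) k = (at_dist E k)\<inverse>"
  by (auto simp: at_dist_def relpow_converse)

text \<open>Reading a triple backwards swaps its two lengths, so type \<open>(1, i)\<close> becomes
  type \<open>(i, 1)\<close> in the reversed digraph.\<close>

lemma card_geodesic_triples_converse:
  "card (geodesic_triples (E\<inverse>) j k) = card (geodesic_triples E k j)"
  by (rule bij_betw_same_card[of "\<lambda>(u, w, z). (z, w, u)"],
      rule bij_betw_byWitness[where f' = "\<lambda>(u, w, z). (z, w, u)"])
     (auto simp: geodesic_triples_def at_dist_converse add.commute)

lemma digraph_converse: "digraph V E \<Longrightarrow> digraph V (E\<inverse>)"
  by (auto simp: digraph_def)

lemma is_dcycle_converse:
  assumes "is_dcycle (E\<inverse>) vs"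
  shows "is_dcycle E (rev vs)"
proof -
  have ne: "vs \<noteq> []" and step: "\<And>i. i < length vs - 1 \<Longrightarrow> (vs ! (i + 1), vs ! i) \<in> E"
    using assms by (auto simp: is_dcycle_def)
  have "(rev vs ! i, rev vs ! (i + 1)) \<in> E" if "i < length vs - 1" for i
    using step[of "length vs - 1 - (i + 1)"] that
    by (auto simp: rev_nth Suc_diff_Suc)
  then show ?thesis using assms ne
    by (auto simp: is_dcycle_def last_rev hd_rev)
qed

lemma m_free_converse: "m_free m E \<Longrightarrow> m_free m (E\<inverse>)"
  using is_dcycle_converse unfolding m_free_def by (metis length_rev)

section \<open>Existence of a sparse cut\<close>

lemma sparse_cut_if_minimal:
  assumes G: "digraph V E" and free: "m_free m E" and V: "V \<noteq> {}"
    and no_sink: "\<And>w. w \<in> V \<Longrightarrow> \<exists>z. (w, z) \<in> E"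
    and i: "1 \<le> i" "i \<le> m - 2"
    and min1: "\<And>j. 1 \<le> j \<Longrightarrow> j \<le> m - 2 \<Longrightarrow>
      card (geodesic_triples E i 1) \<le> card (geodesic_triples E j 1)"
    and min2: "\<And>j. 1 \<le> j \<Longrightarrow> j \<le> m - 2 \<Longrightarrow>
      card (geodesic_triples E i 1) \<le> card (geodesic_triples E 1 j)"
  shows "\<exists>S. S \<noteq> {} \<and> S \<subset> V \<and>
    (m - 2) * card (cut_edges E S) \<le> card (cut_nonedges V E S)"
proof -
  let ?t = "card (geodesic_triples E i 1)"
  define S where "S w = {z. \<exists>k. 1 \<le> k \<and> k \<le> i \<and> (w, z) \<in> at_dist E k}" for w
  \<comment> \<open>These are the \<open>m - 2\<close> types of the average; the second range starts
    at 2 because \<open>(1, 1)\<close> is already in the first. For \<open>(j, k)\<close> in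
    \<open>P\<close>, \<open>k \<le> i\<close> puts \<open>z\<close> into \<open>S w\<close>,
    \<open>j + i \<le> m\<close> keeps \<open>u\<close> out, and \<open>j + k \<le> m - 1\<close>
    makes \<open>u\<close> and \<open>z\<close> nonadjacent.\<close>
  define P where "P = {1..m - 1 - i} \<times> {1} \<union> {1} \<times> {2..i}"
  define A where "A w = {(x, y). (w, x, y) \<in> geodesic_triples E i 1}" for w
  \<comment> \<open>Here \<open>w\<close> is the middle of the triple, whereas in \<open>A w\<close>
    it is the start. The pair is stored as \<open>(z, u)\<close> to match
    \<open>cut_nonedges\<close>, as \<open>z\<close> is the end in \<open>S w\<close>.\<close>
  define B where "B w p = {(z, u). (u, w, z) \<in> geodesic_triples E (fst p) (snd p)}" for w p
  have fin: "finite V" using G by (simp add: digraph_def)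
  have triple_V: "u \<in> V \<and> w \<in> V \<and> z \<in> V"
    if "(u, w, z) \<in> geodesic_triples E j k" "1 \<le> j" "1 \<le> k" for u w z j k
    using that at_dist_carrier[OF G] unfolding geodesic_triples_def by blast
  have P_bounds: "1 \<le> j \<and> 1 \<le> k \<and> k \<le> i \<and> j + i \<le> m \<and> j + k \<le> m - 1" if "(j, k) \<in> P" for j k
    using that i by (auto simp: P_def)
  have finP: "finite P" by (simp add: P_def)
  have "card P = (m - 1 - i) + (i - 1)"
    unfolding P_def by (subst card_Un_disjoint) auto
  then have cardP: "card P = m - 2" using i by simp
  have S_V: "S w \<subseteq> V" for w
    unfolding S_def using at_dist_carrier[OF G] by blast
  have S_self: "w \<notin> S w" for w
    unfolding S_def at_dist_def by force
  have S_ne: "S w \<noteq> {}" if "w \<in> V" for w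
    using no_sink[OF that] edge_at_dist_1[OF G] i unfolding S_def by blast
  have edges: "cut_edges E (S w) \<subseteq> A w" for w
  proof clarify
    fix x y assume "(x, y) \<in> cut_edges E (S w)"
    then have xy: "(x, y) \<in> E" and xS: "x \<in> S w" and yS: "y \<notin> S w"
      by (auto simp: cut_edges_def)
    obtain k where k: "1 \<le> k" "k \<le> i" "(w, x) \<in> at_dist E k" using xS S_def by blast
    have wy: "(w, y) \<in> E ^^ Suc k" using at_dist_relpow[OF k(3)] xy by auto
    then obtain l where l: "l \<le> Suc k" "(w, y) \<in> at_dist E l" by (rule relpow_imp_at_dist)
    \<comment> \<open>Distance 0 needs its own argument: \<open>w\<close> lies outside
      \<open>S w\<close>, so \<open>y \<notin> S w\<close> alone does not rule out
      \<open>y = w\<close>.\<close>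
    have "l \<noteq> 0"
    proof
      assume "l = 0"
      then have "(w, w) \<in> E ^^ Suc k" using l wy by (auto simp: at_dist_def)
      then show False using m_free_no_closed_walk[OF free, of "Suc k" w] k i by force
    qed
    with l yS have "i < l" unfolding S_def
      by (metis (mono_tags, lifting) One_nat_def Suc_leI bot_nat_0.not_eq_extremum
          linorder_not_le mem_Collect_eq)
    with l k have "k = i" "l = i + 1" by auto
    then show "(x, y) \<in> A w"
      using k l edge_at_dist_1[OF G xy] by (simp add: A_def geodesic_triples_def)
  qed
  have nonedges: "(\<Union>p\<in>P. B w p) \<subseteq> cut_nonedges V E (S w)" for w
  proof clarify
    fix j k z u assume jk: "(j, k) \<in> P" and "(z, u) \<in> B w (j, k)"
    then have tri: "(u, w, z) \<in> geodesic_triples E j k" by (simp add: B_def)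
    then have d: "(u, w) \<in> at_dist E j" "(w, z) \<in> at_dist E k" "(u, z) \<in> at_dist E (j + k)"
      by (auto simp: geodesic_triples_def)
    note b = P_bounds[OF jk]
    have "z \<in> S w" using b d by (auto simp: S_def)
    moreover have "u \<notin> S w"
    proof
      assume "u \<in> S w"
      then obtain l where l: "1 \<le> l" "l \<le> i" "(w, u) \<in> at_dist E l" by (auto simp: S_def)
      have "(u, u) \<in> E ^^ (j + l)"
        using at_dist_relpow[OF d(1)] at_dist_relpow[OF l(3)] by (auto simp: relpow_add)
      then show False using m_free_no_closed_walk[OF free, of "j + l" u] l b by auto
    qed
    moreover have "u \<in> V" using triple_V[OF tri] b by blast
    moreover have "(u, z) \<notin> E" "(z, u) \<notin> E"
      using at_dist_nonadjacent[OF free _ _ d(3)] b by auto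
    ultimately show "(z, u) \<in> cut_nonedges V E (S w)" by (simp add: cut_nonedges_def)
  qed
  have finA: "finite (A w)" for w
    by (rule finite_subset[of _ "V \<times> V"]) (use fin triple_V i in \<open>auto simp: A_def\<close>)
  have finB: "finite (B w p)" if "p \<in> P" for w p
    by (rule finite_subset[of _ "V \<times> V"])
      (use fin triple_V P_bounds[of "fst p" "snd p"] that in \<open>auto simp: B_def\<close>)
  have fin_non: "finite (cut_nonedges V E (S w))" for w
    by (rule finite_subset[of _ "V \<times> V"]) (use fin S_V in \<open>auto simp: cut_nonedges_def\<close>)
  \<comment> \<open>Double counting: each triple is counted once, at its first vertex here and at
    its middle vertex in \<open>sumB\<close>.\<close>
  have sumA: "(\<Sum>w\<in>V. card (A w)) = ?t"
  proof -
    have "(SIGMA w:V. A w) = geodesic_triples E i 1"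
      using triple_V i by (auto simp: A_def)
    then show ?thesis using card_SigmaI[of V A] fin finA by simp
  qed
  have sumB: "(\<Sum>w\<in>V. card (B w p)) = card (geodesic_triples E (fst p) (snd p))" if p: "p \<in> P" for p
  proof -
    have "card (SIGMA w:V. B w p) = card (geodesic_triples E (fst p) (snd p))"
      by (rule bij_betw_same_card[of "\<lambda>(w, z, u). (u, w, z)"],
          rule bij_betw_byWitness[where f' = "\<lambda>(u, w, z). (w, z, u)"])
         (use triple_V P_bounds[of "fst p" "snd p"] p in \<open>auto simp: B_def\<close>)
    then show ?thesis using card_SigmaI[of V "\<lambda>w. B w p"] fin finB p by simp
  qed
  \<comment> \<open>Given \<open>w\<close>, the pair \<open>(z, u)\<close> determines both distances
    and hence the type, so different types contribute disjoint sets.\<close>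
  have card_UB: "card (\<Union>p\<in>P. B w p) = (\<Sum>p\<in>P. card (B w p))" for w
  proof (rule card_UN_disjoint[OF finP])
    show "\<forall>p\<in>P. finite (B w p)" using finB by blast
    show "\<forall>p\<in>P. \<forall>q\<in>P. p \<noteq> q \<longrightarrow> B w p \<inter> B w q = {}"
      by (auto simp: B_def geodesic_triples_def dest: at_dist_unique)
  qed
  have "(\<Sum>w\<in>V. (m - 2) * card (cut_edges E (S w))) \<le> (\<Sum>w\<in>V. (m - 2) * card (A w))"
    by (intro sum_mono mult_left_mono card_mono edges finA) simp
  also have "\<dots> = (\<Sum>p\<in>P. ?t)"
    using sumA cardP by (simp flip: sum_distrib_left)
  \<comment> \<open>Every type in \<open>P\<close> is \<open>(j, 1)\<close> or \<open>(1, j)\<close>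
    with \<open>1 \<le> j \<le> m - 2\<close>, so the minimality of \<open>(i, 1)\<close>
    applies.\<close>
  also have "\<dots> \<le> (\<Sum>p\<in>P. card (geodesic_triples E (fst p) (snd p)))"
    by (rule sum_mono) (use i min1 min2 in \<open>auto simp: P_def\<close>)
  also have "\<dots> = (\<Sum>w\<in>V. \<Sum>p\<in>P. card (B w p))"
    using sumB by (subst sum.swap) simp
  also have "\<dots> \<le> (\<Sum>w\<in>V. card (cut_nonedges V E (S w)))"
    unfolding card_UB[symmetric] by (intro sum_mono card_mono nonedges fin_non)
  finally have le: "(\<Sum>w\<in>V. (m - 2) * card (cut_edges E (S w)))
    \<le> (\<Sum>w\<in>V. card (cut_nonedges V E (S w)))" .
  \<comment> \<open>If the inequality failed at every \<open>w\<close>, summing over the nonempty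
    \<open>V\<close> would contradict \<open>le\<close>.\<close>
  obtain w where w: "w \<in> V" "(m - 2) * card (cut_edges E (S w)) \<le> card (cut_nonedges V E (S w))"
    using le sum_strict_mono[OF fin V, of "\<lambda>w. card (cut_nonedges V E (S w))"]
    by (metis (no_types, lifting) linorder_not_le)
  have "S w \<subset> V" using S_V S_self w(1) by blast
  then show ?thesis using S_ne w by blast
qed

text \<open>No edge leaves \<open>{w}\<close> for a sink \<open>w\<close>, or \<open>V - {w}\<close>
  for a source \<open>w\<close>. Without sinks and sources, the averaging argument applies to
  \<open>E\<close> or to its reversal, according to which family contains the rarest type.\<close>

lemma sparse_cut:
  assumes G: "digraph V E" and free: "m_free m E" and m: "3 \<le> m" and V: "2 \<le> card V"
  shows "\<exists>S. S \<noteq> {} \<and> S \<subset> V \<and>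
    (m - 2) * card (cut_edges E S) \<le> card (cut_nonedges V E S)"
proof -
  have ne: "V \<noteq> {}" and single: "\<And>w. V \<noteq> {w}" using V by auto
  have EV: "E \<subseteq> V \<times> V" using G by (simp add: digraph_def)
  consider (sink) w where "w \<in> V" "\<And>z. (w, z) \<notin> E"
    | (source) w where "w \<in> V" "\<And>z. (z, w) \<notin> E"
    | (neither) "\<And>w. w \<in> V \<Longrightarrow> \<exists>z. (w, z) \<in> E" "\<And>w. w \<in> V \<Longrightarrow> \<exists>z. (z, w) \<in> E"
    by blast
  then show ?thesis
  proof cases
    case sink
    then have "cut_edges E {w} = {}" by (auto simp: cut_edges_def)
    then show ?thesis using sink single by (intro exI[of _ "{w}"]) auto
  next
    case source
    then have "cut_edges E (V - {w}) = {}" using EV by (auto simp: cut_edges_def)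
    then show ?thesis using source single by (intro exI[of _ "V - {w}"]) auto
  next
    case neither
    let ?f = "\<lambda>j. card (geodesic_triples E j 1)" and ?g = "\<lambda>j. card (geodesic_triples E 1 j)"
    let ?J = "{1..m - 2}"
    have J: "finite ?J" "?J \<noteq> {}" using m by auto
    obtain a where a: "a \<in> ?J" "\<And>j. j \<in> ?J \<Longrightarrow> ?f a \<le> ?f j"
      using arg_min_if_finite[OF J, of ?f] by (metis linorder_not_le)
    obtain b where b: "b \<in> ?J" "\<And>j. j \<in> ?J \<Longrightarrow> ?g b \<le> ?g j"
      using arg_min_if_finite[OF J, of ?g] by (metis linorder_not_le)
    show ?thesis
    proof (cases "?f a \<le> ?g b")
      case True
      show ?thesis
        by (rule sparse_cut_if_minimal[OF G free ne neither(1), of a])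
           (use a b(1) le_trans[OF True b(2)] in auto)
    next
      case False
      have "\<exists>S. S \<noteq> {} \<and> S \<subset> V \<and>
          (m - 2) * card (cut_edges (E\<inverse>) S) \<le> card (cut_nonedges V (E\<inverse>) S)"
      proof (rule sparse_cut_if_minimal[OF digraph_converse[OF G] m_free_converse[OF free] ne, of b],
             unfold card_geodesic_triples_converse)
        from False have "?g b \<le> ?f a" by simp
        then show "?g b \<le> ?f j" if "1 \<le> j" "j \<le> m - 2" for j
          using a(2)[of j] that by simp
      qed (use b neither(2) in auto)
      then obtain S where S: "S \<noteq> {}" "S \<subset> V"
        "(m - 2) * card (cut_edges (E\<inverse>) S) \<le> card (cut_nonedges V (E\<inverse>) S)" by blast
      \<comment> \<open>Reversal turns edges leaving \<open>S\<close> into edges entering it, so the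
        cut for \<open>E\<close> is the complement.\<close>
      have "cut_edges (E\<inverse>) S = (cut_edges E (V - S))\<inverse>"
        using EV S(2) by (auto simp: cut_edges_def)
      moreover have "cut_nonedges V (E\<inverse>) S = (cut_nonedges V E (V - S))\<inverse>"
        using S(2) by (auto simp: cut_nonedges_def)
      ultimately show ?thesis using S by (intro exI[of _ "V - S"]) auto
    qed
  qed
qed

section \<open>Induction along cuts\<close>

lemma m_free_subset:
  assumes "m_free m E" "F \<subseteq> E"
  shows "m_free m F"
  using assms unfolding m_free_def is_dcycle_def by blast

lemma digraph_induced:
  assumes "digraph V E" "S \<subseteq> V"
  shows "digraph S (E \<inter> S \<times> S)"
  using assms by (auto simp: digraph_def intro: finite_subset)

text \<open>A walk can pass from \<open>T\<close> to \<open>S\<close> but never return, so a closed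
  walk stays on one side and uses only \<open>A\<close> or only \<open>B\<close>.\<close>

lemma acyclic_union_one_way:
  assumes "acyclic A" "acyclic B" "A \<subseteq> S \<times> S" "B \<subseteq> T \<times> T" "C \<subseteq> T \<times> S" "S \<inter> T = {}"
  shows "acyclic (A \<union> B \<union> C)"
proof -
  let ?R = "A \<union> B \<union> C"
  have inS: "(x, y) \<in> A\<^sup>+ \<and> y \<in> S" if "(x, y) \<in> ?R\<^sup>+" "x \<in> S" for x y
    using that
  proof (induction rule: trancl_induct)
    case (base y)
    then show ?case using assms by blast
  next
    case (step y z)
    then have "(y, z) \<in> A" "z \<in> S" using assms by blast+
    then show ?case using step by (blast intro: trancl_into_trancl)
  qed
  have inT: "y \<in> S \<or> (x, y) \<in> B\<^sup>+ \<and> y \<in> T" if "(x, y) \<in> ?R\<^sup>+" "x \<in> T" for x y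
    using that
  proof (induction rule: trancl_induct)
    case (base y)
    then show ?case using assms by blast
  next
    case (step y z)
    show ?case
    proof (cases "y \<in> S")
      case True
      then show ?thesis using step assms by blast
    next
      case False
      then have "(x, y) \<in> B\<^sup>+" "y \<in> T" using step by auto
      moreover from this have "(y, z) \<in> B \<and> z \<in> T \<or> z \<in> S" using step(2) assms by blast
      ultimately show ?thesis by (blast intro: trancl_into_trancl)
    qed
  qed
  show ?thesis
    unfolding acyclic_def
  proof clarify
    fix x assume x: "(x, x) \<in> ?R\<^sup>+"
    then have "x \<in> S \<union> T" using assms by (auto elim: tranclE)
    then show False
      using inS[OF x] inT[OF x] assms(1,2,6) by (auto simp: acyclic_def)
  qed
qed

text \<open>Nonadjacent pairs inside \<open>S\<close>, inside \<open>V - S\<close> and across the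
  cut form three disjoint families; this lets the bounds add up in the induction.\<close>

lemma gamma_cut:
  assumes G: "digraph V E" and S: "S \<subseteq> V"
  shows "gamma S (E \<inter> S \<times> S) + gamma (V - S) (E \<inter> (V - S) \<times> (V - S)) + card (cut_nonedges V E S)
    \<le> gamma V E"
proof -
  let ?N = "\<lambda>V E. {{a, b} | a b. a \<in> V \<and> b \<in> V \<and> a \<noteq> b \<and> (a, b) \<notin> E \<and> (b, a) \<notin> E}"
  define A where "A = ?N S (E \<inter> S \<times> S)"
  define B where "B = ?N (V - S) (E \<inter> (V - S) \<times> (V - S))"
  define C where "C = (\<lambda>(x, y). {x, y}) ` cut_nonedges V E S"
  have "finite V" using G by (simp add: digraph_def)
  then have finN: "finite (?N V E)"
    by (rule rev_finite_subset[OF finite_Pow_iff[THEN iffD2]]) auto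
  have "A \<subseteq> ?N V E" unfolding A_def using S by blast
  moreover have "B \<subseteq> ?N V E" unfolding B_def by blast
  moreover have "C \<subseteq> ?N V E"
    unfolding C_def
  proof (rule image_subsetI, clarify)
    fix x y assume "(x, y) \<in> cut_nonedges V E S"
    then have "x \<in> V \<and> y \<in> V \<and> x \<noteq> y \<and> (x, y) \<notin> E \<and> (y, x) \<notin> E"
      using S by (auto simp: cut_nonedges_def)
    then show "\<exists>a b. {x, y} = {a, b} \<and> a \<in> V \<and> b \<in> V \<and> a \<noteq> b \<and> (a, b) \<notin> E \<and> (b, a) \<notin> E"
      by blast
  qed
  ultimately have sub: "A \<subseteq> ?N V E" "B \<subseteq> ?N V E" "C \<subseteq> ?N V E" .
  note fin = sub[THEN finite_subset, OF finN]
  have "inj_on (\<lambda>(x, y). {x, y}) (cut_nonedges V E S)"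
    by (auto simp: inj_on_def cut_nonedges_def doubleton_eq_iff)
  then have cardC: "card C = card (cut_nonedges V E S)" unfolding C_def by (rule card_image)
  have inA: "X \<subseteq> S \<and> X \<noteq> {}" if "X \<in> A" for X using that by (auto simp: A_def)
  have inB: "X \<inter> S = {} \<and> X \<noteq> {}" if "X \<in> B" for X using that by (auto simp: B_def)
  have inC: "\<not> X \<subseteq> S \<and> X \<inter> S \<noteq> {}" if "X \<in> C" for X
    using that by (auto simp: C_def cut_nonedges_def)
  have "A \<inter> B = {}" "(A \<union> B) \<inter> C = {}" using inA inB inC by blast+
  then have "card A + card B + card C = card (A \<union> B \<union> C)"
    using fin by (simp add: card_Un_disjoint)
  also have "\<dots> \<le> card (?N V E)" using sub by (intro card_mono finN Un_least)
  finally show ?thesis unfolding gamma_def cardC A_def B_def .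
qed

text \<open>Delete feedback arc sets of the two sides and all edges from \<open>S\<close> to
  \<open>V - S\<close>. The edges going back from \<open>V - S\<close> to \<open>S\<close> survive,
  but they cross in one direction only.\<close>

lemma small_feedback_arc_set:
  assumes "digraph V E" "m_free m E" "3 \<le> m"
  shows "\<exists>X\<subseteq>E. acyclic (E - X) \<and> (m - 2) * card X \<le> gamma V E"
  using assms
proof (induction "card V" arbitrary: V E rule: less_induct)
  case less
  have fin: "finite V" and EV: "E \<subseteq> V \<times> V" and loop: "\<And>v. (v, v) \<notin> E"
    using less.prems(1) by (auto simp: digraph_def)
  show ?case
  proof (cases "2 \<le> card V")
    case False
    then have "card V \<le> Suc 0" by simp
    then have "\<And>x y. x \<in> V \<Longrightarrow> y \<in> V \<Longrightarrow> x = y" using fin by (simp add: card_le_Suc0_iff_eq)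
    then have "E = {}" using EV loop by fast
    then show ?thesis by (auto simp: acyclic_def)
  next
    case True
    from sparse_cut[OF less.prems True] obtain S where S: "S \<noteq> {}" "S \<subset> V"
      and cut: "(m - 2) * card (cut_edges E S) \<le> card (cut_nonedges V E S)" by blast
    let ?T = "V - S"
    let ?E1 = "E \<inter> S \<times> S" and ?E2 = "E \<inter> ?T \<times> ?T"
    have "card S < card V" "card ?T < card V"
      using S fin by (auto intro!: psubset_card_mono)
    moreover have "digraph S ?E1" "digraph ?T ?E2"
      using S less.prems(1) by (auto intro!: digraph_induced)
    moreover have "m_free m ?E1" "m_free m ?E2"
      using less.prems(2) by (auto intro: m_free_subset)
    ultimately obtain X Y where X: "X \<subseteq> ?E1" "acyclic (?E1 - X)" "(m - 2) * card X \<le> gamma S ?E1"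
      and Y: "Y \<subseteq> ?E2" "acyclic (?E2 - Y)" "(m - 2) * card Y \<le> gamma ?T ?E2"
      using less.hyps less.prems(3) by meson
    let ?Z = "X \<union> Y \<union> cut_edges E S"
    have "acyclic ((?E1 - X) \<union> (?E2 - Y) \<union> E \<inter> ?T \<times> S)"
      by (rule acyclic_union_one_way[where S = S and T = ?T]) (use X(2) Y(2) in auto)
    then have "acyclic (E - ?Z)"
      by (rule acyclic_subset) (use EV in \<open>auto simp: cut_edges_def\<close>)
    moreover have "?Z \<subseteq> E" using X Y by (auto simp: cut_edges_def)
    moreover have "(m - 2) * card ?Z \<le> gamma V E"
    proof -
      have "card ?Z \<le> card X + card Y + card (cut_edges E S)"
        by (meson add_le_mono1 card_Un_le order_trans)
      then have "(m - 2) * card ?Z \<le> (m - 2) * card X + (m - 2) * card Y + (m - 2) * card (cut_edges E S)"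
        by (metis add_mult_distrib2 mult_le_mono2)
      then show ?thesis
        using X(3) Y(3) cut gamma_cut[OF less.prems(1) psubset_imp_subset[OF S(2)]] by linarith
    qed
    ultimately show ?thesis by blast
  qed
qed

theorem theorem1p4:
  fixes V :: "'a set" and E :: "('a \<times> 'a) set" and m :: nat
  assumes "m \<ge> 4" and "digraph V E" and "m_free m E"
  shows "real (beta E) \<le> real (gamma V E) / real (m - 2)"
proof -
  obtain X where X: "X \<subseteq> E" "acyclic (E - X)" "(m - 2) * card X \<le> gamma V E"
    using small_feedback_arc_set[OF assms(2,3)] assms(1) by auto
  have "finite E"
    using assms(2) unfolding digraph_def by (meson finite_SigmaI finite_subset)
  \<comment> \<open>Finiteness of the candidate set is what allows \<open>Min_le\<close> to compare
    \<open>beta E\<close> with \<open>card X\<close>.\<close>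
  then have "finite {card X | X. X \<subseteq> E \<and> dacyclic (E - X)}" by simp
  then have "beta E \<le> card X"
    unfolding beta_def by (rule Min_le) (use X acyclic_imp_dacyclic in blast)
  then have "(m - 2) * beta E \<le> gamma V E"
    using X(3) by (meson mult_le_mono2 order_trans)
  then have "real (m - 2) * real (beta E) \<le> real (gamma V E)"
    by (metis of_nat_le_iff of_nat_mult)
  then show ?thesis
    using assms(1) by (simp add: pos_le_divide_eq mult.commute)
qed

end
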